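(* Let $n\in\mathbb{N}$ and $s\in\mathbb{C}\setminus\{-1,-2,-3,\dots\}$. Then \begin{align*} &\sum_{k=1}^{n}\binom{s+n}{k}\frac{(-1)^{k-1}}{k^2}[\psi(s+n+1)-\psi(s+n-k+1)]\\ &=\sum_{k=0}^{n-1}\frac{(-1)^k}{k+1}\binom{s+k}{k}\frac{H_n-H_k}{(n-k)\binom{n}{k}} +s\sum_{k=0}^{n-1}\frac{(-1)^k}{k+1}\binom{s+k}{k}\frac{H_n-H_k}{(n-k)\binom{n}{k}}[\psi(s+k+1)-\psi(s+1)]. \end{align*}
   Context: $\psi=\Gamma'/\Gamma$ is the digamma function. $H_m=\sum_{j=1}^m\frac1j$, $H_0=0$. For $z\in\mathbb{C}$ and $k\in\mathbb{N}_0$, $\binom{z}{k}=\frac{z(z-1)\cdots(z-k+1)}{k!}$. *)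

theory Defs
  imports "HOL-Analysis.Analysis"
begin

text \<open>
  The library defines \<^const>\<open>Digamma\<close> by a series; on the domain of \<^const>\<open>Gamma\<close> it is the
  logarithmic derivative of \<^const>\<open>Gamma\<close>.
\<close>

lemma Digamma_eq_deriv_Gamma_div_Gamma:
  fixes z :: complex
  assumes "z \<notin> \<int>\<^sub>\<le>\<^sub>0"
  shows "Digamma z = deriv Gamma z / Gamma z"
proof -
  have "deriv Gamma z = Gamma z * Digamma z"
    by (rule DERIV_imp_deriv) (rule has_field_derivative_Gamma[OF assms])
  moreover have "Gamma z \<noteq> 0"
    using assms by (simp add: Gamma_eq_zero_iff)
  ultimately show ?thesis by simp
qed

end

theory Submission
  imports Defs
begin

text \<open>
  Since \<open>d/ds\<close> of \<open>s + n gchoose k\<close> is \<open>(s + n gchoose k) * (\<psi>(s+n+1) - \<psi>(s+n-k+1))\<close>, the claim is the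
  derivative in \<open>s\<close> of a polynomial identity: the Newton expansion, in the basis \<open>-s gchoose j\<close>, of
  \<open>\<Sum>k. (s + n gchoose k) * (-1)^(k-1) / k^2\<close>. Up to sign, its coefficients are iterated differences of
  \<open>1/k^2\<close>, and its constant term disappears under differentiation.
\<close>

text \<open>Pascal's rule for iterated differences: up to sign the sum of order m is the m-th
  forward difference of \<open>f\<close> at 0, so raising the order by one subtracts the same
  difference of the shifted \<open>f\<close>.\<close>

lemma alternating_binomial_sum_Suc:
  fixes f :: "nat \<Rightarrow> 'a::comm_ring_1"
  shows "(\<Sum>i\<le>Suc m. (-1) ^ i * of_nat (Suc m choose i) * f i) =
    (\<Sum>i\<le>m. (-1) ^ i * of_nat (m choose i) * f i) -
    (\<Sum>i\<le>m. (-1) ^ i * of_nat (m choose i) * f (Suc i))"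
proof -
  have "(\<Sum>i\<le>Suc m. (-1) ^ i * of_nat (m choose i) * f i) =
      f 0 - (\<Sum>i\<le>m. (-1) ^ i * of_nat (m choose Suc i) * f (Suc i))"
    by (subst sum.atMost_Suc_shift) (simp add: sum_negf)
  then show ?thesis
    by (subst sum.atMost_Suc_shift) (simp add: algebra_simps sum.distrib sum_negf sum_subtractf binomial_eq_0)
qed

text \<open>Conceptually this is minus the derivative at x = j + 1 of the partial fraction identity
  \<Sum>i. (-1)^i (m choose i) / (x + i) = m! / (x (x+1) ... (x+m)), the harmonic difference being
  the logarithmic derivative. The proof is an induction on m; j stays arbitrary because the
  difference recursion moves j to j + 1.\<close>

lemma alternating_binomial_sum_inverse_square:
  "(\<Sum>i\<le>m. (-1) ^ i * of_nat (m choose i) * (1 / of_nat (Suc (j + i)) ^ 2)) =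
    (harm (Suc (j + m)) - harm j) * fact m * fact j / (fact (Suc (j + m)) :: 'a::real_normed_field)"
proof (induction m arbitrary: j)
  case 0
  have "of_nat (Suc j) \<noteq> (0::'a)" by (rule of_nat_neq_0)
  then show ?case
    by (simp add: harm_Suc field_simps power2_eq_square del: of_nat_Suc)
next
  case (Suc m)
  define N :: 'a where "N = of_nat (Suc (Suc (j + m)))"
  define J :: 'a where "J = of_nat (Suc j)"
  define M :: 'a where "M = of_nat (Suc m)"
  have nz: "N \<noteq> 0" "J \<noteq> 0"
    unfolding N_def J_def by (rule of_nat_neq_0)+
  \<comment> \<open>With this relation the induction step is a rational identity in N, J, the
    harmonic numbers and the factorials.\<close>
  have M: "M = N - J" by (simp add: M_def N_def J_def)
  have h: "harm (Suc (Suc (j + m))) = harm (Suc (j + m)) + 1 / N"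
    "harm (Suc j) = harm j + 1 / J"
    by (simp_all add: harm_Suc N_def J_def inverse_eq_divide)
  have f: "fact (Suc (Suc (j + m))) = N * (fact (Suc (j + m)) :: 'a)"
    "fact (Suc j) = J * (fact j :: 'a)" "fact (Suc m) = M * (fact m :: 'a)"
    by (simp_all only: N_def J_def M_def fact_Suc)
  have g: "fact (Suc (j + m)) \<noteq> (0 :: 'a)" by (rule fact_nonzero)
  have "(\<Sum>i\<le>Suc m. (-1) ^ i * of_nat (Suc m choose i) * (1 / of_nat (Suc (j + i)) ^ 2)) =
      (harm (Suc (j + m)) - harm j) * fact m * fact j / (fact (Suc (j + m)) :: 'a) -
      (harm (Suc (Suc j + m)) - harm (Suc j)) * fact m * fact (Suc j) / fact (Suc (Suc j + m))"
    unfolding alternating_binomial_sum_Suc Suc.IH[symmetric] by simp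
  also have "\<dots> = (harm (Suc (j + Suc m)) - harm j) * fact (Suc m) * fact j
      / fact (Suc (j + Suc m))"
    unfolding add_Suc add_Suc_right h f M using nz g by (simp add: divide_simps del: fact_Suc) algebra
  finally show ?case .
qed

text \<open>Evaluates the coefficient of the Newton basis element of index j + 1. Substituting k = j
  + 1 + i turns it into the previous sum of order m = n - j - 1.\<close>

lemma alternating_binomial_sum_inverse_square_shifted:
  assumes "j < n"
  shows "(\<Sum>k=Suc j..n. of_nat (n - Suc j choose (k - Suc j)) * ((-1) ^ (k - 1) / of_nat k ^ 2)) =
    (-1) ^ j * ((harm n - harm j) /
      ((of_nat n - of_nat j) * of_nat (n choose j) :: 'a::real_normed_field))"
proof -
  define m where "m = n - Suc j"
  have n: "n = Suc (j + m)" using assms by (simp add: m_def)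
  have "(\<Sum>k=Suc j..n. of_nat (n - Suc j choose (k - Suc j)) * ((-1) ^ (k - 1) / of_nat k ^ 2)) =
     (\<Sum>i\<le>m. of_nat (m choose i) * ((-1) ^ (j + i) / of_nat (Suc (j + i)) ^ 2 :: 'a))"
    by (rule sum.reindex_bij_witness[of _ "\<lambda>i. Suc (j + i)" "\<lambda>k. k - Suc j"]) (auto simp: n)
  also have "\<dots> = (-1) ^ j *
      (\<Sum>i\<le>m. (-1) ^ i * of_nat (m choose i) * (1 / of_nat (Suc (j + i)) ^ 2))"
    by (simp add: sum_distrib_left power_add mult_ac)
  also have "\<dots> = (-1) ^ j * ((harm n - harm j) * (fact m * fact j / fact n))"
    by (simp only: alternating_binomial_sum_inverse_square n) simp
  \<comment> \<open>The factor n - j = m + 1 cancels against (m + 1)! in the denominator of the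
    binomial coefficient.\<close>
  also have "fact m * fact j / fact n = 1 / ((of_nat n - of_nat j) * of_nat (n choose j) :: 'a)"
  proof -
    have "of_nat n - of_nat j = (of_nat (Suc m) :: 'a)" by (simp add: n)
    moreover have "of_nat (n choose j) = fact n / (fact j * fact (Suc m) :: 'a)"
      by (subst binomial_fact) (simp_all add: n Suc_diff_le)
    moreover have "of_nat (Suc m) \<noteq> (0::'a)" by (rule of_nat_neq_0)
    ultimately show ?thesis by (simp only: fact_Suc) (simp add: field_simps del: of_nat_Suc)
  qed
  finally show ?thesis by simp
qed

text \<open>Negate the upper index, split k - s - n - 1 as -s plus k - n - 1, apply Vandermonde, and
  negate both factors back. The s-dependent factor is (-1)^j times -s gchoose j, hence the Newton
  basis.\<close>

lemma gbinomial_add_of_nat_expand: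
  fixes s :: "'a::field_char_0"
  assumes "k \<le> n"
  shows "(s + of_nat n) gchoose k =
    (\<Sum>j=0..k. ((s + of_nat j - 1) gchoose j) * of_nat (n - j choose (k - j)))"
proof -
  have "(s + of_nat n) gchoose k = (-1) ^ k * ((- s + (of_nat k - of_nat n - 1)) gchoose k)"
    by (subst gbinomial_negated_upper) (simp add: algebra_simps)
  also have "\<dots> = (\<Sum>j=0..k. (-1) ^ k * ((- s gchoose j) *
      ((of_nat k - of_nat n - 1) gchoose (k - j))))"
    by (simp only: gbinomial_Vandermonde[symmetric] sum_distrib_left)
  also have "\<dots> = (\<Sum>j=0..k. ((s + of_nat j - 1) gchoose j) * of_nat (n - j choose (k - j)))"
  proof (rule sum.cong[OF refl])
    fix j assume "j \<in> {0..k}"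
    then have j: "j \<le> k" by simp
    have "((of_nat k - of_nat n - 1) gchoose (k - j)) =
        (-1) ^ (k - j) * (of_nat (n - j) gchoose (k - j) :: 'a)"
      using j assms by (subst gbinomial_negated_upper) (simp add: of_nat_diff)
    \<comment> \<open>The signs of the three negations cancel, their exponents adding up to
      2k.\<close>
    moreover have "(-1) ^ k * ((-1) ^ j * (-1) ^ (k - j)) = (1::'a)"
      using j by (simp flip: power_add)
    moreover have "e * ((p * x) * (q * y)) = x * y" if "e * (p * q) = 1" for e p q x y :: 'a
      using that by algebra
    ultimately show "(-1) ^ k * ((- s gchoose j) * ((of_nat k - of_nat n - 1) gchoose (k - j))) =
        ((s + of_nat j - 1) gchoose j) * of_nat (n - j choose (k - j))"
      by (simp only: gbinomial_minus binomial_gbinomial)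
  qed
  finally show ?thesis .
qed

lemma binomial_inverse_square_sum_newton:
  fixes s :: "'a::real_normed_field"
  assumes "n \<ge> 1"
  shows "(\<Sum>k=1..n. ((s + of_nat n) gchoose k) * ((-1) ^ (k - 1) / of_nat k ^ 2)) =
    (\<Sum>k=1..n. of_nat (n choose k) * ((-1) ^ (k - 1) / of_nat k ^ 2)) +
    s * (\<Sum>k=0..n-1. ((-1) ^ k / (of_nat k + 1)) * ((s + of_nat k) gchoose k) *
      ((harm n - harm k) / ((of_nat n - of_nat k) * of_nat (n choose k))))"
proof -
  define a :: "nat \<Rightarrow> 'a" where "a k = (-1) ^ (k - 1) / of_nat k ^ 2" for k
  \<comment> \<open>The index is moved by one: \<open>b j\<close> is basis element j + 1, so that
    element 0, the part constant in s, is split off as n choose k.\<close>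
  define b where "b j = (s + of_nat j) gchoose Suc j" for j
  have "(s + of_nat n) gchoose k = of_nat (n choose k) +
      (\<Sum>j<k. b j * of_nat (n - Suc j choose (k - Suc j)))" if "k \<le> n" for k
  proof (cases k)
    case (Suc k')
    show ?thesis
      unfolding gbinomial_add_of_nat_expand[OF that] unfolding Suc
      by (simp add: atLeast0AtMost sum.atMost_Suc_shift lessThan_Suc_atMost b_def del: sum.atMost_Suc)
  qed simp
  then have "(\<Sum>k=1..n. ((s + of_nat n) gchoose k) * a k) =
      (\<Sum>k=1..n. of_nat (n choose k) * a k) +
      (\<Sum>k=1..n. \<Sum>j | j \<in> {0..n-1} \<and> j < k.
        b j * (of_nat (n - Suc j choose (k - Suc j)) * a k))"
    unfolding sum.distrib[symmetric]
    by (intro sum.cong refl)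
      (auto simp: distrib_right sum_distrib_right mult.assoc intro!: sum.cong)
  also have "(\<Sum>k=1..n. \<Sum>j | j \<in> {0..n-1} \<and> j < k.
        b j * (of_nat (n - Suc j choose (k - Suc j)) * a k)) =
      (\<Sum>j=0..n-1. b j * (\<Sum>k=Suc j..n. of_nat (n - Suc j choose (k - Suc j)) * a k))"
    by (subst sum.swap_restrict) (auto simp: sum_distrib_left intro!: sum.cong)
  also have "\<dots> = s * (\<Sum>k=0..n-1. ((-1) ^ k / (of_nat k + 1)) * ((s + of_nat k) gchoose k) *
      ((harm n - harm k) / ((of_nat n - of_nat k) * of_nat (n choose k))))"
  proof (subst sum_distrib_left[of s], rule sum.cong[OF refl])
    fix j assume "j \<in> {0..n-1}"
    then have j: "j < n" using assms by auto
    \<comment> \<open>Both absorption identities give (s + j) * ((s + j - 1) gchoose j), without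
      dividing by s + j. This extracts the factor s.\<close>
    have "(of_nat j + 1) * b j = s * ((s + of_nat j) gchoose j)"
      using gbinomial_absorption[of j "s + of_nat j"] gbinomial_absorb_comp[of "s + of_nat j" j]
      by (simp add: b_def add.commute)
    moreover have "of_nat j + 1 \<noteq> (0::'a)" using of_nat_eq_0_iff[of "Suc j"] by (simp add: add.commute)
    ultimately have b: "b j = s * ((s + of_nat j) gchoose j) / (of_nat j + 1)"
      by (simp add: field_simps)
    show "b j * (\<Sum>k=Suc j..n. of_nat (n - Suc j choose (k - Suc j)) * a k) =
        s * ((-1) ^ j / (of_nat j + 1) * ((s + of_nat j) gchoose j) *
        ((harm n - harm j) / ((of_nat n - of_nat j) * of_nat (n choose j))))"
      unfolding a_def alternating_binomial_sum_inverse_square_shifted[OF j] b by simp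
  qed
  finally show ?thesis unfolding a_def .
qed

text \<open>Away from the roots 0, ..., k - 1 the logarithmic derivative is the sum of the 1 / (z -
  i), which the recurrence of \<open>Digamma\<close> telescopes.\<close>

lemma has_field_derivative_gbinomial_Digamma:
  fixes z :: complex
  assumes "\<And>i. i < k \<Longrightarrow> z \<noteq> of_nat i"
  shows "((\<lambda>z. z gchoose k) has_field_derivative
    (z gchoose k) * (Digamma (z + 1) - Digamma (z - of_nat k + 1))) (at z)"
  using assms
proof (induction k)
  case (Suc k)
  have step: "w gchoose Suc k = (w gchoose k) * (w - of_nat k) / of_nat (Suc k)" for w :: complex
    by (simp add: gbinomial_prod_rev mult_ac)
  have nz: "z - of_nat k \<noteq> 0" using Suc.prems[of k] by simp
  have dg: "Digamma (z - of_nat k + 1) = Digamma (z - of_nat (Suc k) + 1) + 1 / (z - of_nat k)"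
    using Digamma_plus1[OF nz] by simp
  have "((\<lambda>w. (w gchoose k) * (w - of_nat k) / of_nat (Suc k)) has_field_derivative
      ((z gchoose k) * (Digamma (z + 1) - Digamma (z - of_nat k + 1)) * (z - of_nat k)
        + (z gchoose k)) / of_nat (Suc k)) (at z)"
    using Suc by (auto intro!: derivative_eq_intros simp: of_nat_neq_0 simp del: of_nat_Suc)
  also have "((z gchoose k) * (Digamma (z + 1) - Digamma (z - of_nat k + 1)) * (z - of_nat k)
        + (z gchoose k)) / of_nat (Suc k) =
      (z gchoose k) * (z - of_nat k) / of_nat (Suc k) *
        (Digamma (z + 1) - Digamma (z - of_nat (Suc k) + 1))"
    unfolding dg using nz by (simp add: field_simps del: of_nat_Suc)
  finally show ?case
    unfolding step .
qed auto

lemma has_field_derivative_gbinomial_shift: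
  fixes s :: complex
  assumes "\<And>m::nat. m \<ge> 1 \<Longrightarrow> s \<noteq> - of_nat m" and "k \<le> n"
  shows "((\<lambda>s. (s + of_nat n) gchoose k) has_field_derivative
    ((s + of_nat n) gchoose k) *
      (Digamma (s + of_nat n + 1) - Digamma (s + of_nat n - of_nat k + 1))) (at s)"
proof -
  \<comment> \<open>Since i < k \<le> n, a root would force s = -(n - i), an excluded negative
    integer.\<close>
  have "s + of_nat n \<noteq> of_nat i" if "i < k" for i
    using assms(1)[of "n - i"] assms(2) that by (auto simp: of_nat_diff algebra_simps)
  then show ?thesis
    using DERIV_shift[of "\<lambda>z. z gchoose k" _ s "of_nat n"] has_field_derivative_gbinomial_Digamma
    by blast
qed

theorem theorem2p10:
  fixes n :: nat and s :: complex
  assumes "n \<ge> 1"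
    and "\<And>m::nat. m \<ge> 1 \<Longrightarrow> s \<noteq> - of_nat m"
  shows
    "(\<Sum>k=1..n. ((s + of_nat n) gchoose k) * ((-1) ^ (k - 1) / of_nat k ^ 2) *
        (Digamma (s + of_nat n + 1) - Digamma (s + of_nat n - of_nat k + 1)))
     = (\<Sum>k=0..n-1. ((-1) ^ k / (of_nat k + 1)) * ((s + of_nat k) gchoose k) *
          ((harm n - harm k) / ((of_nat n - of_nat k) * of_nat (n choose k))))
       + s * (\<Sum>k=0..n-1. ((-1) ^ k / (of_nat k + 1)) * ((s + of_nat k) gchoose k) *
          ((harm n - harm k) / ((of_nat n - of_nat k) * of_nat (n choose k))) *
          (Digamma (s + of_nat k + 1) - Digamma (s + 1)))"
proof -
  let ?c = "\<lambda>k. (harm n - harm k) / ((of_nat n - of_nat k) * of_nat (n choose k)) :: complex"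
  let ?f = "\<lambda>s::complex. \<Sum>k=1..n. ((s + of_nat n) gchoose k) * ((-1) ^ (k - 1) / of_nat k ^ 2)"
  let ?g = "\<lambda>s::complex. \<Sum>k=0..n-1. ((-1) ^ k / (of_nat k + 1)) * ((s + of_nat k) gchoose k) * ?c k"
  let ?D = "\<lambda>n k. ((s + of_nat n) gchoose k) *
    (Digamma (s + of_nat n + 1) - Digamma (s + of_nat n - of_nat k + 1))"
  let ?f' = "\<Sum>k=1..n. ?D n k * ((-1) ^ (k - 1) / of_nat k ^ 2)"
  \<comment> \<open>For \<open>?D k k\<close> the second argument s + k - k + 1 collapses to s +
    1.\<close>
  let ?g' = "\<Sum>k=0..n-1. ((-1) ^ k / (of_nat k + 1)) * ?D k k * ?c k"
  note D = has_field_derivative_gbinomial_shift[OF assms(2)]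
  have "(?f has_field_derivative ?f') (at s)"
    by (intro DERIV_sum DERIV_cmult_right D) auto
  moreover have "(?g has_field_derivative ?g') (at s)"
    by (intro DERIV_sum DERIV_cmult_right DERIV_cmult D) auto
  from DERIV_add[OF DERIV_const DERIV_mult[OF DERIV_ident this]]
  have "((\<lambda>s. (\<Sum>k=1..n. of_nat (n choose k) * ((-1) ^ (k - 1) / of_nat k ^ 2)) + s * ?g s)
      has_field_derivative ?g s + s * ?g') (at s)"
    by (simp only: mult_1_left add_0 mult.commute[of ?g' s])
  \<comment> \<open>The Newton identity holds for every s, so it may be rewritten under the binder;
    both derivatives then belong to one function.\<close>
  then have "(?f has_field_derivative ?g s + s * ?g') (at s)"
    by (simp only: binomial_inverse_square_sum_newton[OF assms(1)])
  ultimately have "?f' = ?g s + s * ?g'"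
    by (rule DERIV_unique)
  then show ?thesis
    by (simp add: mult_ac)
qed

end
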